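(* Let $k\in\frac12\mathbb{Z}$, let $v$ be a multiplier system on $\mathrm{SL}(2,\mathbb{Z})$ compatible with $k$, and let $\nu\in\mathbb{C}$. Assume that $e^{\mp\pi i(2\nu-1)}\neq e^{\pi ik}$ (for both choices of sign), and put $$c^\star_\pm=1-e^{\pi ik}e^{\pm\pi i(2\nu-1)}.$$ Then there is a bijection between functions $f:\mathbb{C}\smallsetminus\mathbb{R}\to\mathbb{C}$ satisfying $v(T)^{-1}f(\zeta+1)=f(\zeta)$ for all $\zeta\in\mathbb{C}\smallsetminus\mathbb{R}$, and functions $P:\mathbb{C}\smallsetminus\mathbb{R}\to\mathbb{C}$ satisfying the three-term equation $$P(\zeta)=v(T)^{-1}P(\zeta+1)+v(T')^{-1}(\zeta+1)^{2\nu-1}P\left(\frac{\zeta}{\zeta+1}\right)\qquad(\zeta\in\mathbb{C}\smallsetminus\mathbb{R}).$$ The bijection is given by the (mutually inverse) formulas $$c^\star_\pm f(\zeta)=P(\zeta)+v(S)^{-1}\zeta^{2\nu-1}P\left(-\frac1\zeta\right)\qquad(\mathrm{Im}(\zeta)\gtrless0)$$ (with $c^\star_+$ for $\mathrm{Im}(\zeta)>0$ and $c^\star_-$ for $\mathrm{Im}(\zeta)<0$) and $$P(\zeta)=f(\zeta)-v(S)^{-1}\zeta^{2\nu-1}f\left(-\frac1\zeta\right)\qquad(\zeta\in\mathbb{C}\smallsetminus\mathbb{R}).$$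
   Context: Arguments: $\arg(w)\in(-\pi,\pi]$ for $w\in\mathbb{C}\smallsetminus\{0\}$, and $w^s=|w|^s e^{is\arg(w)}$. Matrices: $S=\begin{pmatrix}0&-1\\1&0\end{pmatrix}$, $T=\begin{pmatrix}1&1\\0&1\end{pmatrix}$, $T'=TST=\begin{pmatrix}1&0\\1&1\end{pmatrix}$. For $\gamma=\begin{pmatrix}a&b\\c&d\end{pmatrix}$ put $\gamma z=\frac{az+b}{cz+d}$ and $\mu(\gamma,z)=cz+d$. Multiplier system compatible with weight $k\in\frac12\mathbb{Z}$: a function $v:\mathrm{SL}(2,\mathbb{Z})\to\mathbb{C}\smallsetminus\{0\}$ with $v(\gamma\delta)e^{ik\arg\mu(\gamma\delta,z)}=v(\gamma)v(\delta)e^{ik\arg\mu(\gamma,\delta z)}e^{ik\arg\mu(\delta,z)}$ for all $\gamma,\delta\in\mathrm{SL}(2,\mathbb{Z})$ and $z$ in the upper half-plane, and with $v(-I)=e^{-ik\pi}$, where $I$ is the identity matrix. *)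

theory Defs
  imports "HOL-Analysis.Analysis"
begin

definition SL2Z :: "(int^2^2) set" where
  "SL2Z = {\<gamma>. det \<gamma> = 1}"

definition mat_S :: "int^2^2" where
  "mat_S = vector [vector [0, -1], vector [1, 0]]"

definition mat_T :: "int^2^2" where
  "mat_T = vector [vector [1, 1], vector [0, 1]]"

definition mat_T' :: "int^2^2" where
  "mat_T' = mat_T ** mat_S ** mat_T"

lemma mat_T'_explicit: "mat_T' = vector [vector [1, 0], vector [1, 1]]"
  by (simp add: mat_T'_def mat_T_def mat_S_def matrix_matrix_mult_def
      vec_eq_iff sum_2 forall_2)

lemma generators_in_SL2Z: "mat_S \<in> SL2Z" "mat_T \<in> SL2Z" "mat_T' \<in> SL2Z"
  by (simp_all add: SL2Z_def mat_S_def mat_T_def mat_T'_explicit det_2)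

definition moebius :: "int^2^2 \<Rightarrow> complex \<Rightarrow> complex" where
  "moebius \<gamma> z =
     (of_int (\<gamma> $ 1 $ 1) * z + of_int (\<gamma> $ 1 $ 2)) / (of_int (\<gamma> $ 2 $ 1) * z + of_int (\<gamma> $ 2 $ 2))"

definition mu :: "int^2^2 \<Rightarrow> complex \<Rightarrow> complex" where
  "mu \<gamma> z = of_int (\<gamma> $ 2 $ 1) * z + of_int (\<gamma> $ 2 $ 2)"

text \<open>Only the values of \<open>v\<close> on \<open>SL2Z\<close> matter. The library function \<open>Arg\<close> takes
  values in \<open>(-\<pi>, \<pi>]\<close>, and the complex power \<open>powr\<close> used below is built from the
  same branch.\<close>

definition multiplier_system :: "real \<Rightarrow> (int^2^2 \<Rightarrow> complex) \<Rightarrow> bool" where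
  "multiplier_system k v \<longleftrightarrow>
     (\<forall>\<gamma>\<in>SL2Z. v \<gamma> \<noteq> 0) \<and>
     (\<forall>\<gamma>\<in>SL2Z. \<forall>\<delta>\<in>SL2Z. \<forall>z. Im z > 0 \<longrightarrow>
        v (\<gamma> ** \<delta>) * exp (\<i> * of_real k * of_real (Arg (mu (\<gamma> ** \<delta>) z))) =
        v \<gamma> * v \<delta> * exp (\<i> * of_real k * of_real (Arg (mu \<gamma> (moebius \<delta> z))))
                * exp (\<i> * of_real k * of_real (Arg (mu \<delta> z)))) \<and>
     v (- mat 1) = exp (- (\<i> * of_real k * of_real pi))"

text \<open>Functions \<open>\<complex> - \<real> \<rightarrow> \<complex>\<close> are represented as extensional functions, i.e.
  \<open>undefined\<close> on the real line, so that equality in these sets is equality on \<open>\<complex> - \<real>\<close>.\<close>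

definition periodic_functions :: "(int^2^2 \<Rightarrow> complex) \<Rightarrow> (complex \<Rightarrow> complex) set" where
  "periodic_functions v =
     {f \<in> (- \<real>) \<rightarrow>\<^sub>E UNIV. \<forall>\<zeta>\<in>- \<real>. inverse (v mat_T) * f (\<zeta> + 1) = f \<zeta>}"

definition three_term_solutions ::
    "(int^2^2 \<Rightarrow> complex) \<Rightarrow> complex \<Rightarrow> (complex \<Rightarrow> complex) set" where
  "three_term_solutions v \<nu> =
     {P \<in> (- \<real>) \<rightarrow>\<^sub>E UNIV. \<forall>\<zeta>\<in>- \<real>.
        P \<zeta> = inverse (v mat_T) * P (\<zeta> + 1)
            + inverse (v mat_T') * (\<zeta> + 1) powr (2 * \<nu> - 1) * P (\<zeta> / (\<zeta> + 1))}"

definition cstar_plus :: "real \<Rightarrow> complex \<Rightarrow> complex" where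
  "cstar_plus k \<nu> = 1 - exp (of_real pi * \<i> * of_real k) * exp (of_real pi * \<i> * (2 * \<nu> - 1))"

definition cstar_minus :: "real \<Rightarrow> complex \<Rightarrow> complex" where
  "cstar_minus k \<nu> = 1 - exp (of_real pi * \<i> * of_real k) * exp (- (of_real pi * \<i> * (2 * \<nu> - 1)))"

end

theory Submission
  imports Defs
begin

text \<open>Write \<open>(P|S) \<zeta> = v(S)\<^sup>-\<^sup>1 \<zeta>\<^sup>s P(-1/\<zeta>)\<close> with \<open>s = 2\<nu> - 1\<close>, and similarly for \<open>T\<close> and \<open>T'\<close>.
  The phases of the powers and the value \<open>v(S)\<^sup>2 = exp(-\<i>\<pi>k)\<close> make \<open>|S|S\<close> multiplication by
  \<open>1 - c\<^sup>\<star>\<close> on each half-plane, so \<open>f \<mapsto> f - f|S\<close> and \<open>P \<mapsto> (P + P|S)/c\<^sup>\<star>\<close> are mutually inverse.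
  If \<open>f|T = f\<close>, then \<open>f|S|T' = f|S\<close> and \<open>f|T' = f|S|T\<close>, which gives the three-term equation for
  \<open>f - f|S\<close>. Conversely, applying \<open>|S|T\<close> to the three-term equation yields \<open>P|S|T = P|T' + P|S\<close>, and
  adding the equation itself shows that \<open>P + P|S\<close> is invariant under \<open>T\<close>.\<close>

section \<open>Principal logarithms and powers off the real line\<close>

text \<open>The points \<open>\<zeta>\<close> and \<open>\<zeta> + 1\<close> lie in the same open
  half-plane, so their arguments differ by less than \<pi> and the difference of the logarithms
  stays in the principal strip.\<close>

lemma Ln_div_add_1:
  assumes "Im \<zeta> \<noteq> 0"
  shows "Ln (\<zeta> / (\<zeta> + 1)) = Ln \<zeta> - Ln (\<zeta> + 1)"
proof -
  have nz: "\<zeta> \<noteq> 0" "\<zeta> + 1 \<noteq> 0" and im: "Im (\<zeta> + 1) = Im \<zeta>"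
    using assms by (auto simp: complex_eq_iff)
  have "\<bar>Im (Ln \<zeta>) - Im (Ln (\<zeta> + 1))\<bar> < pi"
  proof (cases "Im \<zeta> > 0")
    case True
    then show ?thesis
      using Im_Ln_pos_lt_imp[of \<zeta>] Im_Ln_pos_lt_imp[of "\<zeta> + 1"] nz im
        Im_Ln_pos_lt[of \<zeta>] Im_Ln_pos_lt[of "\<zeta> + 1"] by auto
  next
    case False
    then have "Im \<zeta> < 0" using assms by simp
    then have "- pi < Im (Ln \<zeta>)" "Im (Ln \<zeta>) < 0" "- pi < Im (Ln (\<zeta> + 1))" "Im (Ln (\<zeta> + 1)) < 0"
      using Im_Ln_pos_le[of \<zeta>] Im_Ln_pos_le[of "\<zeta> + 1"] nz im
        mpi_less_Im_Ln[of \<zeta>] mpi_less_Im_Ln[of "\<zeta> + 1"] Im_Ln_le_pi[of \<zeta>] Im_Ln_le_pi[of "\<zeta> + 1"]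
      by auto
    then show ?thesis by auto
  qed
  then have "Ln (exp (Ln \<zeta> - Ln (\<zeta> + 1))) = Ln \<zeta> - Ln (\<zeta> + 1)"
    by (intro Ln_exp) auto
  then show ?thesis using nz by (simp add: exp_diff)
qed

text \<open>Additivity of the logarithms means that no phase arises; this is the cocycle relation of
  the power factors for S T' against S.\<close>

lemma powr_add_1_mult_div:
  assumes "Im \<zeta> \<noteq> 0"
  shows "(\<zeta> + 1) powr s * (\<zeta> / (\<zeta> + 1)) powr s = \<zeta> powr s"
proof -
  have nz: "\<zeta> \<noteq> 0" "\<zeta> + 1 \<noteq> 0"
    using assms by (auto simp: complex_eq_iff)
  then show ?thesis
    by (simp add: powr_def Ln_div_add_1[OF assms] flip: exp_add) (simp add: algebra_simps)
qed

text \<open>The logarithms of \<open>\<zeta>\<close> and \<open>- 1 / \<zeta>\<close> add up to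
  \<i>\<pi> in the upper and -\<i>\<pi> in the lower half-plane. This sign is the source of the two
  constants.\<close>

lemma powr_mult_powr_minus_inverse:
  assumes "Im \<zeta> \<noteq> 0"
  shows "\<zeta> powr s * (- 1 / \<zeta>) powr s =
    (if Im \<zeta> > 0 then exp (of_real pi * \<i> * s) else exp (- (of_real pi * \<i> * s)))"
proof -
  have nz: "\<zeta> \<noteq> 0" using assms by auto
  have "\<zeta> \<notin> \<real>\<^sub>\<le>\<^sub>0" using assms by (auto simp: complex_nonpos_Reals_iff)
  then have inv: "Ln (inverse \<zeta>) = - Ln \<zeta>" by (rule Ln_inverse)
  \<comment> \<open>\<open>Ln_minus\<close> shifts by \<plusminus>\<i>\<pi> according to the sign of
    the imaginary part, which inversion reverses; nonreality excludes its boundary case.\<close>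
  have sgn: "Im (inverse \<zeta>) \<le> 0 \<longleftrightarrow> Im \<zeta> > 0" "Im (inverse \<zeta>) \<noteq> 0"
    using assms sum_power2_gt_zero_iff[of "Re \<zeta>" "Im \<zeta>"]
    by (auto simp: divide_le_0_iff zero_le_divide_iff)
  have "Ln (- 1 / \<zeta>) = Ln (- inverse \<zeta>)" by (simp add: divide_inverse)
  also have "\<dots> = - Ln \<zeta> + (if Im \<zeta> > 0 then \<i> * pi else - (\<i> * pi))"
    using Ln_minus[of "inverse \<zeta>"] nz inv sgn by auto
  finally have "Ln \<zeta> + Ln (- 1 / \<zeta>) = (if Im \<zeta> > 0 then \<i> * pi else - (\<i> * pi))"
    by simp
  then have "s * Ln \<zeta> + s * Ln (- 1 / \<zeta>) =
      (if Im \<zeta> > 0 then of_real pi * \<i> * s else - (of_real pi * \<i> * s))"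
    unfolding distrib_left[symmetric] by simp
  then show ?thesis using nz
    by (simp add: powr_def flip: exp_add)
qed

section \<open>Values of the multiplier system on the generators\<close>

lemma multiplier_systemD:
  assumes "multiplier_system k v" "\<gamma> \<in> SL2Z" "\<delta> \<in> SL2Z" "Im z > 0"
  shows "v (\<gamma> ** \<delta>) * exp (\<i> * of_real k * of_real (Arg (mu (\<gamma> ** \<delta>) z))) =
        v \<gamma> * v \<delta> * exp (\<i> * of_real k * of_real (Arg (mu \<gamma> (moebius \<delta> z))))
                * exp (\<i> * of_real k * of_real (Arg (mu \<delta> z)))"
  using assms unfolding multiplier_system_def by blast

text \<open>Use the cocycle relation for S S = -I at the fixed point \<i> of S. Both factors on the
  right have argument \<pi>/2, while on the left the phase of -1 cancels v(-I).\<close>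

lemma multiplier_system_S_squared:
  assumes "multiplier_system k v"
  shows "inverse (v mat_S) * inverse (v mat_S) = exp (of_real pi * \<i> * of_real k)"
proof -
  have "mat_S ** mat_S = - mat 1"
    by (simp add: mat_S_def matrix_matrix_mult_def vec_eq_iff sum_2 forall_2 mat_def)
  moreover have "mu mat_S (moebius mat_S \<i>) = \<i>" "mu mat_S \<i> = \<i>" "mu (- mat 1) \<i> = -1"
    by (simp_all add: mu_def moebius_def mat_S_def mat_def)
  moreover have "Arg (- 1) = pi"
    by (simp add: Arg_eq_Im_Ln)
  moreover have "v (- mat 1) = exp (- (\<i> * of_real k * of_real pi))"
    using assms by (simp add: multiplier_system_def)
  ultimately have "1 = v mat_S * v mat_S *
      exp (\<i> * of_real k * of_real (pi/2)) * exp (\<i> * of_real k * of_real (pi/2))"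
    using multiplier_systemD[OF assms generators_in_SL2Z(1) generators_in_SL2Z(1), of \<i>]
    by (simp flip: exp_add)
  also have "\<dots> = v mat_S * v mat_S * exp (of_real pi * \<i> * of_real k)"
    by (simp add: mult.assoc flip: exp_add) (simp add: algebra_simps)
  finally have "v mat_S * v mat_S * exp (of_real pi * \<i> * of_real k) = 1" by simp
  then show ?thesis
    by (metis inverse_mult_distrib inverse_unique)
qed

text \<open>The relation T'(ST) = S gives v(T')v(T) = 1, and T' = T(ST) gives v(T') = v(T)v(S)v(T).
  Thus every weight in the slash actions is a power of v(T).\<close>

lemma multiplier_system_generators:
  assumes "multiplier_system k v"
  shows "inverse (v mat_T') = v mat_T"
    and "inverse (v mat_S) = v mat_T * v mat_T * v mat_T"
proof -
  have nz: "v mat_S \<noteq> 0" "v mat_T \<noteq> 0" "v mat_T' \<noteq> 0"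
    using assms generators_in_SL2Z by (auto simp: multiplier_system_def)
  have ST: "mat_S ** mat_T = vector [vector [0, -1], vector [1, 1]]"
    by (simp add: mat_S_def mat_T_def matrix_matrix_mult_def vec_eq_iff sum_2 forall_2)
  have ST_in: "mat_S ** mat_T \<in> SL2Z"
    by (simp add: ST SL2Z_def det_2)
  have T': "mat_T ** (mat_S ** mat_T) = mat_T'"
    by (simp add: mat_T'_def matrix_mul_assoc)
  have T'ST: "mat_T' ** (mat_S ** mat_T) = mat_S"
    by (simp add: mat_T'_explicit mat_S_def mat_T_def matrix_matrix_mult_def vec_eq_iff sum_2 forall_2)
  have mus: "mu (mat_S ** mat_T) \<i> = \<i> + 1" "mu mat_S (moebius mat_T \<i>) = \<i> + 1" "mu mat_T z = 1"
    "mu mat_T' \<i> = \<i> + 1" "mu mat_S \<i> = \<i>" for z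
    by (simp_all only: ST) (simp_all add: mu_def moebius_def mat_S_def mat_T_def mat_T'_explicit)
  have mu4: "mu mat_T' (moebius (mat_S ** mat_T) \<i>) = \<i> / (\<i> + 1)"
    by (simp add: ST mu_def moebius_def mat_T'_explicit complex_eq_iff field_simps)
  have vST: "v (mat_S ** mat_T) = v mat_S * v mat_T"
    using multiplier_systemD[OF assms generators_in_SL2Z(1,2), of \<i>] by (simp add: mus)
  have vT': "v mat_T' = v mat_T * (v mat_S * v mat_T)"
    using multiplier_systemD[OF assms generators_in_SL2Z(2) ST_in, of \<i>]
    by (simp add: mus T' vST)
  have nz1: "\<i> + 1 \<noteq> 0" by (simp add: complex_eq_iff)
  \<comment> \<open>The automorphy factors of T'(ST) = S at \<i> have arguments that add up exactly,
    without a multiple of 2\<pi>, so all phases cancel.\<close>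
  have Arg: "Arg \<i> = Arg (\<i> / (\<i> + 1)) + Arg (\<i> + 1)"
    using Ln_div_add_1[of \<i>] nz1 by (simp add: Arg_eq_Im_Ln)
  have "v mat_S * exp (\<i> * of_real k * of_real (Arg \<i>)) = v mat_T' * v (mat_S ** mat_T) *
     (exp (\<i> * of_real k * of_real (Arg (\<i> / (\<i> + 1)))) * exp (\<i> * of_real k * of_real (Arg (\<i> + 1))))"
    using multiplier_systemD[OF assms generators_in_SL2Z(3) ST_in, of \<i>]
    unfolding T'ST mus mu4 by simp
  also have "\<dots> = v mat_T' * v (mat_S ** mat_T) * exp (\<i> * of_real k * of_real (Arg \<i>))"
    unfolding Arg by (simp add: algebra_simps flip: exp_add)
  finally have "v mat_S = v mat_T' * (v mat_S * v mat_T)" by (simp add: vST)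
  then have T'T: "v mat_T' * v mat_T = 1" using nz by simp
  then show "inverse (v mat_T') = v mat_T" by (rule inverse_unique)
  have "v mat_S * (v mat_T * v mat_T * v mat_T) = 1"
    using T'T unfolding vT' by (simp add: mult_ac)
  then show "inverse (v mat_S) = v mat_T * v mat_T * v mat_T" by (rule inverse_unique)
qed

section \<open>The action of S and its square\<close>

text \<open>The parameters \<open>b\<close> and \<open>s\<close> stand for v(S)^(-1) and 2\<nu> - 1,
  which keeps the functional equations separate from the multiplier system.\<close>

definition slash_S :: "complex \<Rightarrow> complex \<Rightarrow> (complex \<Rightarrow> complex) \<Rightarrow> complex \<Rightarrow> complex" where
  "slash_S b s P \<zeta> = b * \<zeta> powr s * P (- 1 / \<zeta>)"

text \<open>One locally constant function off the real line lets both half-planes be treated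
  together; its value at real points is a default.\<close>

definition cstar :: "real \<Rightarrow> complex \<Rightarrow> complex \<Rightarrow> complex" where
  "cstar k \<nu> \<zeta> = (if Im \<zeta> > 0 then cstar_plus k \<nu> else cstar_minus k \<nu>)"

text \<open>The imaginary part is divided by the squared modulus. At \<open>\<zeta> = 0\<close> the
  convention 1/0 = 0 makes both equivalences hold.\<close>

lemma Im_minus_inverse:
  "Im (- 1 / \<zeta>) > 0 \<longleftrightarrow> Im \<zeta> > 0" "Im (- 1 / \<zeta>) = 0 \<longleftrightarrow> Im \<zeta> = 0"
proof -
  have "Im (- 1 / \<zeta>) = Im \<zeta> / ((Re \<zeta>)\<^sup>2 + (Im \<zeta>)\<^sup>2)"
    by (simp add: Im_divide)
  then show "Im (- 1 / \<zeta>) > 0 \<longleftrightarrow> Im \<zeta> > 0" "Im (- 1 / \<zeta>) = 0 \<longleftrightarrow> Im \<zeta> = 0"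
    using sum_power2_gt_zero_iff[of "Re \<zeta>" "Im \<zeta>"]
    by (auto simp: zero_less_divide_iff simp del: sum_power2_gt_zero_iff)
qed

lemma cstar_minus_inverse: "cstar k \<nu> (- 1 / \<zeta>) = cstar k \<nu> \<zeta>"
  unfolding cstar_def Im_minus_inverse ..

lemma cstar_add_1: "cstar k \<nu> (\<zeta> + 1) = cstar k \<nu> \<zeta>"
  by (simp add: cstar_def)

lemma slash_S_slash_S:
  assumes "b * b = exp (of_real pi * \<i> * of_real k)" "Im \<zeta> \<noteq> 0"
  shows "slash_S b (2 * \<nu> - 1) (slash_S b (2 * \<nu> - 1) P) \<zeta> = (1 - cstar k \<nu> \<zeta>) * P \<zeta>"
proof -
  have "slash_S b (2 * \<nu> - 1) (slash_S b (2 * \<nu> - 1) P) \<zeta> =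
      (b * b) * (\<zeta> powr (2 * \<nu> - 1) * (- 1 / \<zeta>) powr (2 * \<nu> - 1)) * P \<zeta>"
    by (simp add: slash_S_def)
  then show ?thesis
    unfolding assms(1) powr_mult_powr_minus_inverse[OF assms(2)]
    by (simp add: cstar_def cstar_plus_def cstar_minus_def)
qed

section \<open>Periodicity and the three-term equation\<close>

text \<open>Here \<open>a\<close> is v(T). Periodicity reduces all values of \<open>f\<close> to
  those at \<open>\<zeta>\<close>, \<open>- 1 / \<zeta>\<close> and
  \<open>- 1 / (\<zeta> + 1)\<close>, and the last kind cancels between the two terms on the
  right.\<close>

lemma three_term_of_periodic:
  assumes "a \<noteq> 0" "b = a * a * a"
    and per: "\<And>\<zeta>. Im \<zeta> \<noteq> 0 \<Longrightarrow> f (\<zeta> + 1) = a * f \<zeta>"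
    and P: "\<And>\<zeta>. Im \<zeta> \<noteq> 0 \<Longrightarrow> P \<zeta> = f \<zeta> - slash_S b s f \<zeta>"
    and \<zeta>: "Im \<zeta> \<noteq> 0"
  shows "P \<zeta> = inverse a * P (\<zeta> + 1) + a * (\<zeta> + 1) powr s * P (\<zeta> / (\<zeta> + 1))"
proof -
  have nz: "\<zeta> \<noteq> 0" "\<zeta> + 1 \<noteq> 0" using \<zeta> by (auto simp: complex_eq_iff)
  have U: "\<zeta> / (\<zeta> + 1) = - 1 / (\<zeta> + 1) + 1" using nz by (simp add: field_simps)
  have im1: "Im (\<zeta> + 1) \<noteq> 0" using \<zeta> by simp
  have im2: "Im (- 1 / (\<zeta> + 1)) \<noteq> 0" using im1 Im_minus_inverse by blast
  then have im3: "Im (\<zeta> / (\<zeta> + 1)) \<noteq> 0" unfolding U by simp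
  have im4: "Im (- 1 / \<zeta>) \<noteq> 0" using \<zeta> Im_minus_inverse by blast
  have e1: "f (\<zeta> / (\<zeta> + 1)) = a * f (- 1 / (\<zeta> + 1))"
    unfolding U using per[OF im2] .
  have e2: "- 1 / (\<zeta> / (\<zeta> + 1)) = - 1 / \<zeta> - 1" using nz by (simp add: field_simps)
  \<comment> \<open>S maps \<open>\<zeta> / (\<zeta> + 1)\<close> to
    \<open>- 1 / \<zeta> - 1\<close>, so periodicity is applied at the left neighbour of
    \<open>- 1 / \<zeta>\<close>.\<close>
  have "f ((- 1 / \<zeta> - 1) + 1) = a * f (- 1 / \<zeta> - 1)"
    using im4 by (intro per) simp
  then have e3: "f (- 1 / \<zeta> - 1) = f (- 1 / \<zeta>) / a" using assms(1) by simp
  have "a * (\<zeta> + 1) powr s * P (\<zeta> / (\<zeta> + 1)) =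
      a * a * (\<zeta> + 1) powr s * f (- 1 / (\<zeta> + 1))
      - b * ((\<zeta> + 1) powr s * (\<zeta> / (\<zeta> + 1)) powr s) * f (- 1 / \<zeta>)"
    unfolding P[OF im3] slash_S_def e2 e3 e1 using assms(1) by (simp add: algebra_simps)
  also have "\<dots> = a * a * (\<zeta> + 1) powr s * f (- 1 / (\<zeta> + 1)) - b * \<zeta> powr s * f (- 1 / \<zeta>)"
    by (simp only: powr_add_1_mult_div[OF \<zeta>])
  finally have "a * (\<zeta> + 1) powr s * P (\<zeta> / (\<zeta> + 1)) =
      a * a * (\<zeta> + 1) powr s * f (- 1 / (\<zeta> + 1)) - b * \<zeta> powr s * f (- 1 / \<zeta>)" .
  \<comment> \<open>The factor \<open>b / a = a * a\<close> matches the coefficient from T', which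
    expresses f|S|T = f|T'.\<close>
  moreover have "inverse a * P (\<zeta> + 1) = f \<zeta> - a * a * (\<zeta> + 1) powr s * f (- 1 / (\<zeta> + 1))"
    unfolding P[OF im1] slash_S_def per[OF \<zeta>] using assms(1,2) by (simp add: field_simps)
  ultimately show ?thesis
    unfolding P[OF \<zeta>] slash_S_def by simp
qed

text \<open>Evaluating the three-term equation at \<open>- 1 / (\<zeta> + 1)\<close> produces the
  same T' term as evaluating it at \<open>\<zeta>\<close>, so that term can be eliminated.\<close>

lemma periodic_of_three_term:
  assumes "a \<noteq> 0" "b = a * a * a"
    and P: "\<And>\<zeta>. Im \<zeta> \<noteq> 0 \<Longrightarrow>
      P \<zeta> = inverse a * P (\<zeta> + 1) + a * (\<zeta> + 1) powr s * P (\<zeta> / (\<zeta> + 1))"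
    and \<zeta>: "Im \<zeta> \<noteq> 0"
  shows "inverse a * (P (\<zeta> + 1) + slash_S b s P (\<zeta> + 1)) = P \<zeta> + slash_S b s P \<zeta>"
proof -
  have nz: "\<zeta> \<noteq> 0" "\<zeta> + 1 \<noteq> 0" using \<zeta> by (auto simp: complex_eq_iff)
  have U: "- 1 / (\<zeta> + 1) + 1 = \<zeta> / (\<zeta> + 1)" using nz by (simp add: field_simps)
  have V: "- 1 / (\<zeta> + 1) / (\<zeta> / (\<zeta> + 1)) = - 1 / \<zeta>" using nz by (simp add: field_simps)
  have "Im (\<zeta> + 1) \<noteq> 0" using \<zeta> by simp
  then have im2: "Im (- 1 / (\<zeta> + 1)) \<noteq> 0" using Im_minus_inverse by blast
  \<comment> \<open>This is P|S|T: the equation at \<open>- 1 / (\<zeta> + 1)\<close> multiplied by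
    \<open>a * a * (\<zeta> + 1) powr s\<close>. The coefficient of the last term becomes
    \<open>a * a * a = b\<close>.\<close>
  have "a * a * (\<zeta> + 1) powr s * P (- 1 / (\<zeta> + 1)) =
      a * (\<zeta> + 1) powr s * P (\<zeta> / (\<zeta> + 1))
      + b * ((\<zeta> + 1) powr s * (\<zeta> / (\<zeta> + 1)) powr s) * P (- 1 / \<zeta>)"
    unfolding P[OF im2] U V using assms(1,2) by (simp add: algebra_simps)
  also have "\<dots> = a * (\<zeta> + 1) powr s * P (\<zeta> / (\<zeta> + 1)) + b * \<zeta> powr s * P (- 1 / \<zeta>)"
    by (simp only: powr_add_1_mult_div[OF \<zeta>])
  finally show ?thesis
    using P[OF \<zeta>] assms(1,2) by (simp add: slash_S_def field_simps)
qed

section \<open>The two mutually inverse maps\<close>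

theorem lemma5p8:
  fixes k :: real and v :: "int^2^2 \<Rightarrow> complex" and \<nu> :: complex
  assumes "2 * k \<in> \<int>"
    and "multiplier_system k v"
    and "exp (- (of_real pi * \<i> * (2 * \<nu> - 1))) \<noteq> exp (of_real pi * \<i> * of_real k)"
    and "exp (of_real pi * \<i> * (2 * \<nu> - 1)) \<noteq> exp (of_real pi * \<i> * of_real k)"
  shows "\<exists>\<Phi> \<Psi>.
      bij_betw \<Phi> (periodic_functions v) (three_term_solutions v \<nu>) \<and>
      bij_betw \<Psi> (three_term_solutions v \<nu>) (periodic_functions v) \<and>
      (\<forall>f\<in>periodic_functions v. \<Psi> (\<Phi> f) = f) \<and>
      (\<forall>P\<in>three_term_solutions v \<nu>. \<Phi> (\<Psi> P) = P) \<and>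
      (\<forall>f\<in>periodic_functions v. \<forall>\<zeta>\<in>- \<real>.
         \<Phi> f \<zeta> = f \<zeta> - inverse (v mat_S) * \<zeta> powr (2 * \<nu> - 1) * f (- 1 / \<zeta>)) \<and>
      (\<forall>P\<in>three_term_solutions v \<nu>. \<forall>\<zeta>.
         (Im \<zeta> > 0 \<longrightarrow> cstar_plus k \<nu> * \<Psi> P \<zeta> =
            P \<zeta> + inverse (v mat_S) * \<zeta> powr (2 * \<nu> - 1) * P (- 1 / \<zeta>)) \<and>
         (Im \<zeta> < 0 \<longrightarrow> cstar_minus k \<nu> * \<Psi> P \<zeta> =
            P \<zeta> + inverse (v mat_S) * \<zeta> powr (2 * \<nu> - 1) * P (- 1 / \<zeta>)))"
proof -
  define a b s where "a = v mat_T" and "b = inverse (v mat_S)" and "s = 2 * \<nu> - 1"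
  \<comment> \<open>Restricting to nonreal arguments makes the images extensional, so the inverse
    laws become equalities of functions.\<close>
  define \<Phi> where "\<Phi> f = restrict (\<lambda>\<zeta>. f \<zeta> - slash_S b s f \<zeta>) (- \<real>)" for f
  define \<Psi> where "\<Psi> P = restrict (\<lambda>\<zeta>. (P \<zeta> + slash_S b s P \<zeta>) / cstar k \<nu> \<zeta>) (- \<real>)" for P
  have a0: "a \<noteq> 0"
    using assms(2) generators_in_SL2Z by (auto simp: multiplier_system_def a_def)
  have bb: "b * b = exp (of_real pi * \<i> * of_real k)"
    unfolding b_def by (rule multiplier_system_S_squared[OF assms(2)])
  have b: "b = a * a * a" and w: "inverse (v mat_T') = a"
    unfolding a_def b_def using multiplier_system_generators[OF assms(2)] by auto
  \<comment> \<open>Each constant vanishes exactly if exp(\<i>\<pi>k) is inverse to the exponential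
    in it; the two inequality hypotheses exclude this.\<close>
  have exp_mult_neq_1: "exp y * exp x \<noteq> 1" if "exp (- x) \<noteq> exp y" for x y :: complex
    using that inverse_unique[of "exp x" "exp y"] by (auto simp: exp_minus mult.commute)
  have c0: "cstar k \<nu> \<zeta> \<noteq> 0" for \<zeta>
    using exp_mult_neq_1[OF assms(3)] exp_mult_neq_1[of "- (of_real pi * \<i> * (2 * \<nu> - 1))"] assms(4)
    by (simp add: cstar_def cstar_plus_def cstar_minus_def)
  have nonreal: "\<zeta> \<in> - \<real> \<longleftrightarrow> Im \<zeta> \<noteq> 0" for \<zeta>
    by (simp add: complex_is_Real_iff)
  have inv_nonreal: "- 1 / \<zeta> \<in> - \<real>" if "\<zeta> \<in> - \<real>" for \<zeta> :: complex
    using that Im_minus_inverse(2) nonreal by blast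
  have SS: "slash_S b s (slash_S b s P) \<zeta> = (1 - cstar k \<nu> \<zeta>) * P \<zeta>" if "\<zeta> \<in> - \<real>" for P \<zeta>
    unfolding s_def using slash_S_slash_S[OF bb] that nonreal by blast
  have \<Phi>: "\<Phi> f \<zeta> = f \<zeta> - slash_S b s f \<zeta>" if "\<zeta> \<in> - \<real>" for f \<zeta>
    using that by (simp add: \<Phi>_def)
  have \<Psi>: "\<Psi> P \<zeta> = (P \<zeta> + slash_S b s P \<zeta>) / cstar k \<nu> \<zeta>" if "\<zeta> \<in> - \<real>" for P \<zeta>
    using that by (simp add: \<Psi>_def)
  \<comment> \<open>Since |S|S is multiplication by \<open>1 - cstar\<close>, adding \<Phi> f and
    its image under |S leaves \<open>cstar\<close> times \<open>f\<close>.\<close>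
  have slash_\<Phi>: "slash_S b s (\<Phi> f) \<zeta> = slash_S b s f \<zeta> - (1 - cstar k \<nu> \<zeta>) * f \<zeta>"
    if "\<zeta> \<in> - \<real>" for f \<zeta>
    using SS[OF that, of f] \<Phi>[OF inv_nonreal[OF that], of f]
    by (simp add: slash_S_def[of b s "\<Phi> f"] slash_S_def[of b s f \<zeta>] slash_S_def[of b s "slash_S b s f"]
        right_diff_distrib)
  \<comment> \<open>Division by \<open>cstar\<close> commutes with |S because \<open>cstar\<close>
    is unchanged under \<open>- 1 / \<zeta>\<close>. Subtracting this from \<Psi> P leaves
    \<open>P\<close>.\<close>
  have slash_\<Psi>: "slash_S b s (\<Psi> P) \<zeta> =
      (slash_S b s P \<zeta> + (1 - cstar k \<nu> \<zeta>) * P \<zeta>) / cstar k \<nu> \<zeta>"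
    if "\<zeta> \<in> - \<real>" for P \<zeta>
    using SS[OF that, of P] \<Psi>[OF inv_nonreal[OF that], of P] cstar_minus_inverse[of k \<nu> \<zeta>]
    by (simp add: slash_S_def[of b s "\<Psi> P"] slash_S_def[of b s P \<zeta>] slash_S_def[of b s "slash_S b s P"]
        add_divide_distrib distrib_left)
  have inv1: "\<Psi> (\<Phi> f) = f" if "f \<in> periodic_functions v" for f
  proof (rule PiE_ext)
    show "\<Psi> (\<Phi> f) \<in> - \<real> \<rightarrow>\<^sub>E UNIV" by (simp add: \<Psi>_def)
    show "f \<in> - \<real> \<rightarrow>\<^sub>E UNIV" using that by (simp add: periodic_functions_def)
    show "\<Psi> (\<Phi> f) \<zeta> = f \<zeta>" if "\<zeta> \<in> - \<real>" for \<zeta>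
      using c0 by (simp add: \<Psi>[OF that] slash_\<Phi>[OF that] \<Phi>[OF that] algebra_simps)
  qed
  have inv2: "\<Phi> (\<Psi> P) = P" if "P \<in> three_term_solutions v \<nu>" for P
  proof (rule PiE_ext)
    show "\<Phi> (\<Psi> P) \<in> - \<real> \<rightarrow>\<^sub>E UNIV" by (simp add: \<Phi>_def)
    show "P \<in> - \<real> \<rightarrow>\<^sub>E UNIV" using that by (simp add: three_term_solutions_def)
    show "\<Phi> (\<Psi> P) \<zeta> = P \<zeta>" if "\<zeta> \<in> - \<real>" for \<zeta>
      using c0 by (simp add: \<Phi>[OF that] slash_\<Psi>[OF that] \<Psi>[OF that] field_simps)
  qed
  have \<Phi>_in: "\<Phi> f \<in> three_term_solutions v \<nu>" if "f \<in> periodic_functions v" for f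
  proof -
    have per: "f (\<zeta> + 1) = a * f \<zeta>" if "Im \<zeta> \<noteq> 0" for \<zeta>
      using \<open>f \<in> periodic_functions v\<close> that a0 nonreal[of \<zeta>]
      by (auto simp: periodic_functions_def a_def field_simps)
    have "\<Phi> f \<zeta> = inverse a * \<Phi> f (\<zeta> + 1) + a * (\<zeta> + 1) powr s * \<Phi> f (\<zeta> / (\<zeta> + 1))"
      if "\<zeta> \<in> - \<real>" for \<zeta>
      by (rule three_term_of_periodic[where f = f, OF a0 b])
        (use that per \<Phi> nonreal in auto)
    then show ?thesis
      unfolding three_term_solutions_def w by (simp add: s_def a_def \<Phi>_def)
  qed
  have \<Psi>_in: "\<Psi> P \<in> periodic_functions v" if "P \<in> three_term_solutions v \<nu>" for P
  proof -
    have three: "P \<zeta> = inverse a * P (\<zeta> + 1) + a * (\<zeta> + 1) powr s * P (\<zeta> / (\<zeta> + 1))"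
      if "Im \<zeta> \<noteq> 0" for \<zeta>
      using \<open>P \<in> three_term_solutions v \<nu>\<close> that nonreal[of \<zeta>]
      unfolding three_term_solutions_def w by (simp add: a_def s_def)
    have per: "inverse a * (P (\<zeta> + 1) + slash_S b s P (\<zeta> + 1)) = P \<zeta> + slash_S b s P \<zeta>"
      if "Im \<zeta> \<noteq> 0" for \<zeta>
      using periodic_of_three_term[where P = P, OF a0 b three that] by simp
    \<comment> \<open>The divisor \<open>cstar\<close> agrees at \<open>\<zeta>\<close> and
      \<open>\<zeta> + 1\<close>, so the T-invariance of P + P|S passes to the quotient.\<close>
    have "inverse a * \<Psi> P (\<zeta> + 1) = \<Psi> P \<zeta>" if "\<zeta> \<in> - \<real>" for \<zeta>
    proof -
      have "\<zeta> + 1 \<in> - \<real>" "Im \<zeta> \<noteq> 0" using that nonreal[of \<zeta>] nonreal[of "\<zeta> + 1"] by auto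
      then show ?thesis
        by (simp only: \<Psi> that cstar_add_1 times_divide_eq_right per[OF \<open>Im \<zeta> \<noteq> 0\<close>])
    qed
    then show ?thesis
      unfolding periodic_functions_def by (simp add: a_def \<Psi>_def)
  qed
  show ?thesis
  proof (rule exI[of _ \<Phi>], rule exI[of _ \<Psi>], intro conjI)
    show "bij_betw \<Phi> (periodic_functions v) (three_term_solutions v \<nu>)"
      by (rule bij_betw_byWitness[where f' = \<Psi>]) (use inv1 inv2 \<Phi>_in \<Psi>_in in auto)
    show "bij_betw \<Psi> (three_term_solutions v \<nu>) (periodic_functions v)"
      by (rule bij_betw_byWitness[where f' = \<Phi>]) (use inv1 inv2 \<Phi>_in \<Psi>_in in auto)
    show "\<forall>f\<in>periodic_functions v. \<Psi> (\<Phi> f) = f" using inv1 by blast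
    show "\<forall>P\<in>three_term_solutions v \<nu>. \<Phi> (\<Psi> P) = P" using inv2 by blast
    show "\<forall>f\<in>periodic_functions v. \<forall>\<zeta>\<in>- \<real>.
         \<Phi> f \<zeta> = f \<zeta> - inverse (v mat_S) * \<zeta> powr (2 * \<nu> - 1) * f (- 1 / \<zeta>)"
      using \<Phi> by (simp add: slash_S_def b_def s_def)
    have mult: "cstar k \<nu> \<zeta> * \<Psi> P \<zeta> =
        P \<zeta> + inverse (v mat_S) * \<zeta> powr (2 * \<nu> - 1) * P (- 1 / \<zeta>)" if "Im \<zeta> \<noteq> 0" for P \<zeta>
      using \<Psi>[of \<zeta> P] that nonreal[of \<zeta>] c0[of \<zeta>] by (simp add: slash_S_def b_def s_def)
    show "\<forall>P\<in>three_term_solutions v \<nu>. \<forall>\<zeta>.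
         (Im \<zeta> > 0 \<longrightarrow> cstar_plus k \<nu> * \<Psi> P \<zeta> =
            P \<zeta> + inverse (v mat_S) * \<zeta> powr (2 * \<nu> - 1) * P (- 1 / \<zeta>)) \<and>
         (Im \<zeta> < 0 \<longrightarrow> cstar_minus k \<nu> * \<Psi> P \<zeta> =
            P \<zeta> + inverse (v mat_S) * \<zeta> powr (2 * \<nu> - 1) * P (- 1 / \<zeta>))"
    proof (intro ballI allI conjI impI)
      fix P \<zeta>
      show "cstar_plus k \<nu> * \<Psi> P \<zeta> =
            P \<zeta> + inverse (v mat_S) * \<zeta> powr (2 * \<nu> - 1) * P (- 1 / \<zeta>)" if "Im \<zeta> > 0"
        using mult[of \<zeta> P] that by (simp add: cstar_def)
      show "cstar_minus k \<nu> * \<Psi> P \<zeta> =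
            P \<zeta> + inverse (v mat_S) * \<zeta> powr (2 * \<nu> - 1) * P (- 1 / \<zeta>)" if "Im \<zeta> < 0"
        using mult[of \<zeta> P] that by (simp add: cstar_def)
    qed
  qed
qed

end
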